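(* For every cardinal $\tau$ there is a Tychonoff space $X$ such that $e(X)\geq\tau$ and $we(X)=\omega$.
   Context: For a topological space $X$, the extent of $X$ is the cardinal $e(X)=\sup\{|F| : F\subset X \text{ is closed and discrete}\}$, where "discrete" means discrete in the subspace topology. For a family $\mathcal{U}$ of subsets of $X$ and $A\subset X$, the star of $A$ is $St(A,\mathcal{U})=\bigcup\{U\in\mathcal{U} : U\cap A\neq\emptyset\}$. The weak extent of $X$ is the cardinal $we(X)=\min\{\kappa : \text{for every open cover } \mathcal{U} \text{ of } X \text{ there is } A\subset X \text{ such that } |A|\leq\kappa \text{ and } St(A,\mathcal{U})=X\}$. Here $\omega$ is the first infinite cardinal, and a Tychonoff space is a completely regular Hausdorff space. *)

theory Defs
  imports "HOL-Analysis.Analysis"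
begin

unbundle cardinal_syntax

definition closed_discrete :: "'a topology \<Rightarrow> 'a set \<Rightarrow> bool" where
  "closed_discrete X F \<longleftrightarrow> closedin X F \<and> subtopology X F = discrete_topology F"

definition Star :: "'a set \<Rightarrow> 'a set set \<Rightarrow> 'a set" where
  "Star A \<U> = \<Union>{U \<in> \<U>. U \<inter> A \<noteq> {}}"

definition open_cover :: "'a topology \<Rightarrow> 'a set set \<Rightarrow> bool" where
  "open_cover X \<U> \<longleftrightarrow> (\<forall>U\<in>\<U>. openin X U) \<and> \<Union>\<U> = topspace X"

definition extent_bound :: "'a topology \<Rightarrow> 'k rel \<Rightarrow> bool" where
  "extent_bound X \<kappa> \<longleftrightarrow> (\<forall>F. closed_discrete X F \<longrightarrow> |F| \<le>o \<kappa>)"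

definition weak_extent_bound :: "'a topology \<Rightarrow> 'k rel \<Rightarrow> bool" where
  "weak_extent_bound X \<kappa> \<longleftrightarrow>
     (\<forall>\<U>. open_cover X \<U> \<longrightarrow> (\<exists>A. A \<subseteq> topspace X \<and> |A| \<le>o \<kappa> \<and> Star A \<U> = topspace X))"

text \<open>
  Cardinals are represented by cardinal orders, taken up to the equivalence \<open>=o\<close>; finite ones
  are included. The minimum of a class of cardinals is one of its members that is least for \<open>\<le>o\<close>.
  The cardinal \<open>|topspace X|\<close> satisfies both bounds above, so extent and weak extent can be
  formed among the cardinals on the type of the points of \<open>X\<close>. The lemmas below show that they
  are minimal among the cardinals on all types.
\<close>

definition min_card :: "('a rel \<Rightarrow> bool) \<Rightarrow> 'a rel" where
  "min_card P = (SOME \<kappa>. Card_order \<kappa> \<and> P \<kappa> \<and> (\<forall>\<mu>. Card_order \<mu> \<and> P \<mu> \<longrightarrow> \<kappa> \<le>o \<mu>))"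

text \<open>The supremum of the cardinals \<open>|F|\<close> is their least upper bound.\<close>

definition extent :: "'a topology \<Rightarrow> 'a rel" where
  "extent X = min_card (extent_bound X)"

definition weak_extent :: "'a topology \<Rightarrow> 'a rel" where
  "weak_extent X = min_card (weak_extent_bound X)"

lemma min_card_props:
  assumes "Card_order \<kappa>" "P \<kappa>"
  shows "Card_order (min_card P)" "P (min_card P)"
    "\<And>\<mu>. Card_order \<mu> \<Longrightarrow> P \<mu> \<Longrightarrow> min_card P \<le>o \<mu>"
proof -
  let ?R = "{\<mu>. Card_order \<mu> \<and> P \<mu>}"
  have "\<exists>\<kappa>\<in>?R. \<forall>\<mu>\<in>?R. \<kappa> \<le>o \<mu>"
    by (rule exists_minim_Card_order) (use assms in auto)
  then have "\<exists>\<kappa>. Card_order \<kappa> \<and> P \<kappa> \<and> (\<forall>\<mu>. Card_order \<mu> \<and> P \<mu> \<longrightarrow> \<kappa> \<le>o \<mu>)"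
    by blast
  from someI_ex[OF this]
  show "Card_order (min_card P)" "P (min_card P)"
    "\<And>\<mu>. Card_order \<mu> \<Longrightarrow> P \<mu> \<Longrightarrow> min_card P \<le>o \<mu>"
    unfolding min_card_def by blast+
qed

lemma min_card_le_any_type:
  fixes \<mu> :: "'k rel" and \<kappa> :: "'a rel"
  assumes "Card_order \<kappa>" "P \<kappa>" "Card_order \<mu>"
    and transfer: "\<And>\<nu> :: 'a rel. \<mu> =o \<nu> \<Longrightarrow> P \<nu>"
  shows "min_card P \<le>o \<mu>"
proof (rule ccontr)
  note m = min_card_props[where P = P, OF assms(1,2)]
  assume "\<not> min_card P \<le>o \<mu>"
  then have "\<mu> <o min_card P"
    using m(1) assms(3) by (meson card_order_on_well_order_on not_ordLeq_iff_ordLess)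
  then obtain \<nu> :: "'a rel" where \<nu>: "\<mu> =o \<nu>" "\<nu> <o min_card P"
    using internalize_ordLess[of \<mu> "min_card P"] by blast
  have "Card_order \<nu>"
    using \<nu>(1) assms(3) Card_order_ordIso2 by blast
  then have "min_card P \<le>o \<nu>"
    using m(3) transfer \<nu>(1) by blast
  then show False
    using \<nu>(2) not_ordLess_ordLeq by blast
qed

lemma extent_bound_topspace: "extent_bound X |topspace X|"
  unfolding extent_bound_def closed_discrete_def
  by (auto intro!: card_of_mono1 dest: closedin_subset)

lemma weak_extent_bound_topspace: "weak_extent_bound X |topspace X|"
  unfolding weak_extent_bound_def
proof (intro allI impI exI conjI)
  fix \<U> assume "open_cover X \<U>"
  then show "Star (topspace X) \<U> = topspace X"
    unfolding open_cover_def Star_def by blast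
qed (auto intro: card_of_mono1)

lemma Card_order_extent: "Card_order (extent X)"
  and extent_bound_extent: "extent_bound X (extent X)"
  using min_card_props[where P = "extent_bound X", OF card_of_Card_order extent_bound_topspace]
  by (simp_all add: extent_def)

lemma extent_le:
  assumes "Card_order \<mu>" "extent_bound X \<mu>"
  shows "extent X \<le>o \<mu>"
  unfolding extent_def
  by (rule min_card_le_any_type[where P = "extent_bound X", OF card_of_Card_order extent_bound_topspace assms(1)])
    (use assms(2) in \<open>auto simp: extent_bound_def intro: ordLeq_ordIso_trans\<close>)

lemma Card_order_weak_extent: "Card_order (weak_extent X)"
  and weak_extent_bound_weak_extent: "weak_extent_bound X (weak_extent X)"
  using min_card_props[where P = "weak_extent_bound X",
      OF card_of_Card_order weak_extent_bound_topspace]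
  by (simp_all add: weak_extent_def)

lemma weak_extent_le:
  fixes X :: "'a topology"
  assumes "Card_order \<mu>" "weak_extent_bound X \<mu>"
  shows "weak_extent X \<le>o \<mu>"
  unfolding weak_extent_def
proof (rule min_card_le_any_type[where P = "weak_extent_bound X", OF card_of_Card_order weak_extent_bound_topspace assms(1)])
  show "weak_extent_bound X \<nu>" if "\<mu> =o \<nu>" for \<nu> :: "'a rel"
    using assms(2) that unfolding weak_extent_bound_def by (meson ordLeq_ordIso_trans)
qed

definition Tychonoff_space :: "'a topology \<Rightarrow> bool" where
  "Tychonoff_space X \<longleftrightarrow> completely_regular_space X \<and> Hausdorff_space X"

text \<open>
  A statement cannot quantify existentially over types. A space whose existence is asserted for a
  cardinal \<open>\<tau>\<close> on \<open>'a\<close> therefore has its points in a fixed type built from \<open>'a\<close>;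
  the summand \<^typ>\<open>nat\<close> keeps this type infinite when \<open>'a\<close> is finite.
\<close>

type_synonym 'a point = "('a + nat) set \<times> ('a + nat) set set"

end

theory Submission
  imports Defs "HOL-Library.Countable_Set_Type"
begin

text \<open>
  Let \<open>T\<close> be an infinite set with at least \<open>\<tau>\<close> elements. The space lives in the compact product
  \<open>2\<^sup>T \<times> 2\<^sup>P\<close> of two Cantor cubes, \<open>P\<close> being the power set of \<open>T\<close>. Its points are the pairs \<open>(S, B)\<close>
  with \<open>S \<subseteq> T\<close>, \<open>B \<subseteq> P\<close> and \<open>|B| \<le> |T|\<close>, which form the base, and for each \<open>t \<in> T\<close> the spike
  \<open>({t}, P)\<close>. As a subspace of a compact Hausdorff space it is Tychonoff. Since \<open>|P| > |T|\<close>, the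
  spikes are exactly the points with second coordinate \<open>P\<close>; they form a closed set, and
  the open condition \<open>t \<in> S\<close> separates the spike of \<open>t\<close> from the others. So the spikes are a
  closed discrete set of size \<open>|T|\<close>, which makes the extent large (\<open>card_le_extent_spiked_space\<close>).

  The weak extent is nevertheless countable, for two reasons. First, countably many points of the
  base involve at most \<open>|T|\<close> elements of \<open>P\<close> in total, hence lie in a compact subset of the base.
  This is a strong form of countable compactness, and it yields, for every open cover, a finite
  set whose star contains the base (\<open>finite_star_covers\<close>). Second, given for each \<open>t\<close> a basic
  neighbourhood of the spike of \<open>t\<close> in a member of the cover, only finitely many coordinates
  \<open>F t \<subseteq> T\<close> and \<open>G t \<subseteq> P\<close> are restricted. The union \<open>H\<close> of all \<open>G t\<close> has size at most \<open>|T|\<close>, so every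
  \<open>(S, H)\<close> is in the base, and it is in the neighbourhood of the spike of \<open>t\<close> as soon as \<open>S\<close> agrees
  with \<open>{t}\<close> on \<open>F t\<close>. The digraph with edges from \<open>t\<close> to the elements of \<open>F t\<close> has finite out-degrees, so
  it has a proper colouring with countably many colours
  (\<open>finite_outdegree_countable_colouring\<close>); the colour class of \<open>t\<close> is a suitable \<open>S\<close>. Hence
  countably many points \<open>(S, H)\<close> have a star that contains all spikes
  (\<open>countable_star_covers_spikes\<close>).

  The weak extent is not finite because some infinite family of spikes can be covered by disjoint
  open sets such that each of these spikes lies in only one member of a suitable cover
  (\<open>spiked_space_no_finite_star\<close>).
\<close>

section \<open>Countable colourings of digraphs with finite out-degrees\<close>

text \<open>
  The greedy colouring along \<open>R\<close>: each point takes the first colour that its finitely many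
  predecessors have left free.
\<close>

lemma wf_finite_predecessors_colouring:
  assumes wf: "wf R" and fin: "\<And>y. finite {z. (z, y) \<in> R}"
  shows "\<exists>c :: 'b \<Rightarrow> nat. \<forall>y z. (z, y) \<in> R \<longrightarrow> c z \<noteq> c y"
proof -
  define H :: "('b \<Rightarrow> nat) \<Rightarrow> 'b \<Rightarrow> nat"
    where "H c y = (LEAST n. n \<notin> c ` {z. (z, y) \<in> R})" for c y
  define c where "c = wfrec R H"
  have c_eq: "c y = (LEAST n. n \<notin> c ` {z. (z, y) \<in> R})" for y
  proof -
    have "cut c R y ` {z. (z, y) \<in> R} = c ` {z. (z, y) \<in> R}"
      by (intro image_cong refl) (simp add: cut_apply)
    moreover have "c y = H (cut c R y) y"
      unfolding c_def by (rule wfrec[OF wf])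
    ultimately show ?thesis
      by (simp add: H_def)
  qed
  have "c y \<notin> c ` {z. (z, y) \<in> R}" for y
  proof -
    have "\<exists>n. n \<notin> c ` {z. (z, y) \<in> R}"
      by (intro ex_new_if_finite finite_imageI fin infinite_UNIV_nat)
    then show ?thesis
      by (subst c_eq) (rule LeastI_ex)
  qed
  then have "c z \<noteq> c y" if "(z, y) \<in> R" for y z
    using that by (metis imageI mem_Collect_eq)
  then show ?thesis
    by blast
qed

text \<open>
  The greedy colouring needs an ordering in which every vertex has only finitely many neighbours
  below it, although its in-degree may be infinite. The set of vertices reachable from a given one
  is countable. Fix a well-order of the vertices and let the rank of \<open>y\<close> be the least vertex from
  which \<open>y\<close> is reachable. Ranks cannot increase along an edge, so a neighbour of smaller rank is an
  out-neighbour, and there are finitely many of these. The vertices of one rank are countably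
  many; enumerating them leaves each with finitely many before it, and all of these may be given
  other colours.
\<close>

lemma finite_outdegree_countable_colouring:
  fixes f :: "'b \<Rightarrow> 'b set"
  assumes fin: "\<And>y. finite (f y)"
  shows "\<exists>c :: 'b \<Rightarrow> nat. \<forall>y. \<forall>z\<in>f y. z \<noteq> y \<longrightarrow> c z \<noteq> c y"
proof -
  define E where "E = {(y, z). z \<in> f y}"
  define reach where "reach x = E\<^sup>* `` {x}" for x
  have countable_reach: "countable (reach x)" for x
    unfolding reach_def
  proof (rule countable_rtrancl)
    fix Y :: "'b set" assume "countable Y"
    moreover have "E `` Y = (\<Union>y\<in>Y. f y)"
      by (auto simp: E_def)
    ultimately show "countable (E `` Y)"
      using fin by (simp add: countable_finite)
  qed simp
  obtain W :: "'b rel" where W: "well_order_on UNIV W"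
    using well_order_on[of UNIV] by blast
  have wfW: "wf (W - Id)"
    using W by (simp add: well_order_on_def)
  have totW: "(a, b) \<in> W - Id \<or> (b, a) \<in> W - Id" if "a \<noteq> b" for a b
    using W that unfolding well_order_on_def linear_order_on_def total_on_def by blast
  have "\<exists>x. y \<in> reach x \<and> (\<forall>x'. (x', x) \<in> W - Id \<longrightarrow> y \<notin> reach x')" for y
  proof -
    have "y \<in> {x. y \<in> reach x}"
      by (simp add: reach_def)
    then obtain x where "x \<in> {x. y \<in> reach x}"
      "\<And>x'. (x', x) \<in> W - Id \<Longrightarrow> x' \<notin> {x. y \<in> reach x}"
      using wfE_min[OF wfW] by metis
    then show ?thesis
      by blast
  qed
  then obtain r where r: "\<And>y. y \<in> reach (r y)"
    and r_min: "\<And>x y. (x, r y) \<in> W - Id \<Longrightarrow> y \<notin> reach x"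
    by metis
  \<comment> \<open>The position of \<open>y\<close> in the enumeration of a countable set that contains all vertices of its rank.\<close>
  define idx where "idx y = to_nat_on (reach (r y)) y" for y
  have idx_inj: "y = z" if "r z = r y" "idx z = idx y" for y z
    using that r[of y] r[of z] countable_reach[of "r y"] by (simp add: idx_def)
  define R where "R = {(z, y). z \<in> f y \<and> (r z, r y) \<in> W - Id \<or> r z = r y \<and> idx z < idx y}"
  have "wf R"
  proof (rule wf_subset)
    show "wf (inv_image ((W - Id) <*lex*> less_than) (\<lambda>y. (r y, idx y)))"
      by (intro wf_inv_image wf_lex_prod wfW wf_less_than)
  qed (auto simp: R_def)
  moreover have "finite {z. (z, y) \<in> R}" for y
  proof -
    have "finite {z. r z = r y \<and> idx z < idx y}"
    proof (rule finite_imageD)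
      show "finite (idx ` {z. r z = r y \<and> idx z < idx y})"
        by (rule finite_subset[of _ "{..<idx y}"]) auto
      show "inj_on idx {z. r z = r y \<and> idx z < idx y}"
        using idx_inj by (auto intro!: inj_onI)
    qed
    then have "finite (f y \<union> {z. r z = r y \<and> idx z < idx y})"
      using fin by simp
    then show ?thesis
      by (rule rev_finite_subset) (auto simp: R_def)
  qed
  ultimately obtain c :: "'b \<Rightarrow> nat" where c: "\<And>y z. (z, y) \<in> R \<Longrightarrow> c z \<noteq> c y"
    using wf_finite_predecessors_colouring[of R] by blast
  have "c z \<noteq> c y" if z: "z \<in> f y" "z \<noteq> y" for y z
  proof -
    have "z \<in> reach (r y)"
      using r[of y] z(1) by (auto simp: reach_def E_def intro: rtrancl_into_rtrancl)
    then have "(r y, r z) \<notin> W - Id"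
      using r_min by blast
    then have "r z = r y \<or> (r z, r y) \<in> W - Id"
      using totW by metis
    moreover have "idx z < idx y \<or> idx y < idx z" if "r z = r y"
      using idx_inj[OF that] z(2) by (metis nat_neq_iff)
    ultimately have "(z, y) \<in> R \<or> (y, z) \<in> R"
      using z(1) by (auto simp: R_def)
    then show ?thesis
      using c by metis
  qed
  then show ?thesis
    by blast
qed

section \<open>Finite stars in countably compact regions\<close>

text \<open>
  A maximal set \<open>A\<close> with at most one point in each member of the cover has a star that contains \<open>Y\<close>.
  It is finite: a countably infinite part of it would lie in a compact subset of \<open>Y\<close>, which
  finitely many members of the cover contain, so that one of them would contain two
  points of \<open>A\<close>.
\<close>

lemma finite_star_covers:
  assumes op: "\<And>U. U \<in> \<U> \<Longrightarrow> openin X U" and cov: "Y \<subseteq> \<Union>\<U>"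
    and cpt: "\<And>C. countable C \<Longrightarrow> C \<subseteq> Y \<Longrightarrow> \<exists>K. compactin X K \<and> C \<subseteq> K \<and> K \<subseteq> Y"
  shows "\<exists>A\<subseteq>Y. finite A \<and> Y \<subseteq> Star A \<U>"
proof -
  \<comment> \<open>The sets with at most one point in each member of the cover.\<close>
  define sep where
    "sep = {A. A \<subseteq> Y \<and> (\<forall>U\<in>\<U>. \<forall>x\<in>A \<inter> U. \<forall>y\<in>A \<inter> U. x = y)}"
  have "\<Union>\<C> \<in> sep" if ch: "subset.chain sep \<C>" for \<C>
  proof -
    have "x = y" if "U \<in> \<U>" "A \<in> \<C>" "B \<in> \<C>" "x \<in> A \<inter> U" "y \<in> B \<inter> U" for U A B x y
    proof -
      have "A \<subseteq> B \<or> B \<subseteq> A"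
        using ch that by (auto simp: subset_chain_def)
      moreover have "A \<in> sep" "B \<in> sep"
        using ch that by (auto simp: subset_chain_def)
      ultimately show ?thesis
        using that unfolding sep_def by blast
    qed
    moreover have "\<Union>\<C> \<subseteq> Y"
      using ch by (auto simp: subset_chain_def sep_def)
    ultimately show ?thesis
      unfolding sep_def by blast
  qed
  from subset_Zorn'[OF this] obtain A where A: "A \<in> sep" and
    A_max: "\<And>B. B \<in> sep \<Longrightarrow> A \<subseteq> B \<Longrightarrow> B = A"
    by blast
  have "Y \<subseteq> Star A \<U>"
  proof
    fix x assume x: "x \<in> Y"
    show "x \<in> Star A \<U>"
    proof (rule ccontr)
      assume no: "x \<notin> Star A \<U>"
      then have "insert x A \<in> sep"
        using A x unfolding sep_def Star_def by blast
      then have "x \<in> A"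
        using A_max by blast
      then show False
        using no x cov unfolding Star_def by blast
    qed
  qed
  moreover have "finite A"
  proof (rule ccontr)
    assume "infinite A"
    then obtain C where C: "C \<subseteq> A" "countable C" "infinite C"
      using infinite_countable_subset' by metis
    have "C \<subseteq> Y"
      using C A unfolding sep_def by blast
    then obtain K where K: "compactin X K" "C \<subseteq> K" "K \<subseteq> Y"
      using cpt C by meson
    obtain \<V> where \<V>: "finite \<V>" "\<V> \<subseteq> \<U>" "K \<subseteq> \<Union>\<V>"
      using K cov op compactinD[OF K(1), of \<U>] by (metis subset_trans)
    have "finite (C \<inter> U)" if "U \<in> \<V>" for U
    proof -
      have "\<forall>x\<in>C \<inter> U. \<forall>y\<in>C \<inter> U. x = y"
        using A C(1) \<V>(2) that unfolding sep_def by blast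
      then have "C \<inter> U = {} \<or> (\<exists>x. C \<inter> U = {x})"
        by blast
      then show ?thesis
        by auto
    qed
    then have "finite (\<Union>U\<in>\<V>. C \<inter> U)"
      using \<V>(1) by blast
    moreover have "C \<subseteq> (\<Union>U\<in>\<V>. C \<inter> U)"
      using K(2) \<V>(3) by blast
    ultimately show False
      using C(3) finite_subset by blast
  qed
  moreover have "A \<subseteq> Y"
    using A by (simp add: sep_def)
  ultimately show ?thesis
    by (intro exI[of _ A]) simp
qed

section \<open>The Cantor cube as a topology on a power set\<close>

definition cantor_cube :: "'b set topology" where
  "cantor_cube = pullback_topology UNIV (\<lambda>S x. x \<in> S)
     (product_topology (\<lambda>_. discrete_topology UNIV) UNIV)"

text \<open>
  Points of the cube are sets, and to be near to a set means to agree with it on finitely many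
  elements. This form of the product topology is the only one used in explicit constructions; the
  homeomorphism with the product serves to transfer compactness and the separation axioms.
\<close>

lemma openin_cantor_cube:
  "openin cantor_cube U \<longleftrightarrow> (\<forall>S\<in>U. \<exists>F. finite F \<and> (\<forall>S'. S' \<inter> F = S \<inter> F \<longrightarrow> S' \<in> U))"
    (is "?L \<longleftrightarrow> ?R")
proof
  assume ?L
  then obtain V where
    V: "openin (product_topology (\<lambda>_::'a. discrete_topology (UNIV :: bool set)) UNIV) V"
    and U: "U = (\<lambda>S x. x \<in> S) -` V"
    by (auto simp: cantor_cube_def openin_pullback_topology)
  show ?R
  proof
    fix S assume "S \<in> U"
    then have "(\<lambda>x. x \<in> S) \<in> V"
      using U by simp
    then obtain B where B: "finite {x. B x \<noteq> UNIV}"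
      "(\<lambda>x. x \<in> S) \<in> Pi\<^sub>E UNIV B" "Pi\<^sub>E UNIV B \<subseteq> V"
      using V unfolding openin_product_topology_alt
      by (auto dest!: bspec[where x = "\<lambda>x. x \<in> S"])
    have "S' \<in> U" if S': "S' \<inter> {x. B x \<noteq> UNIV} = S \<inter> {x. B x \<noteq> UNIV}" for S'
    proof -
      have "(x \<in> S') \<in> B x" for x
      proof (cases "B x = UNIV")
        case False
        then have "x \<in> S' \<longleftrightarrow> x \<in> S"
          using S' by blast
        then show ?thesis
          using B(2) by (simp add: PiE_iff)
      qed simp
      then have "(\<lambda>x. x \<in> S') \<in> V"
        using B(3) by (auto simp: PiE_iff)
      then show ?thesis
        using U by simp
    qed
    then show "\<exists>F. finite F \<and> (\<forall>S'. S' \<inter> F = S \<inter> F \<longrightarrow> S' \<in> U)"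
      using B(1) by blast
  qed
next
  assume R: ?R
  define V where "V = {p. Collect p \<in> U}"
  have "openin (product_topology (\<lambda>_::'a. discrete_topology (UNIV :: bool set)) UNIV) V"
    unfolding openin_product_topology_alt
  proof
    fix p assume "p \<in> V"
    then obtain F where F: "finite F" "\<And>S'. S' \<inter> F = Collect p \<inter> F \<Longrightarrow> S' \<in> U"
      using R V_def by blast
    define B where "B x = (if x \<in> F then {p x} else UNIV)" for x
    have "{x. B x \<noteq> UNIV} \<subseteq> F"
      by (auto simp: B_def split: if_splits)
    then have "finite {x. B x \<noteq> UNIV}"
      using F(1) finite_subset by blast
    moreover have "p \<in> Pi\<^sub>E UNIV B"
      by (auto simp: B_def)
    moreover have "Pi\<^sub>E UNIV B \<subseteq> V"
    proof
      fix q assume "q \<in> Pi\<^sub>E UNIV B"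
      then have "q x = p x" if "x \<in> F" for x
        using that by (auto simp: B_def PiE_iff split: if_splits)
      then show "q \<in> V"
        unfolding V_def by (auto intro: F(2))
    qed
    ultimately show "\<exists>B. finite {i \<in> UNIV. B i \<noteq> topspace (discrete_topology UNIV)} \<and>
        (\<forall>i\<in>UNIV. openin (discrete_topology UNIV) (B i)) \<and> p \<in> Pi\<^sub>E UNIV B \<and> Pi\<^sub>E UNIV B \<subseteq> V"
      by (intro exI[of _ B]) simp
  qed
  moreover have "U = (\<lambda>S x. x \<in> S) -` V"
    by (auto simp: V_def)
  ultimately show ?L
    by (auto simp: cantor_cube_def openin_pullback_topology)
qed

lemma topspace_cantor_cube [simp]: "topspace cantor_cube = UNIV"
  by (simp add: cantor_cube_def topspace_pullback_topology)

lemma cantor_cube_homeomorphic: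
  "(cantor_cube :: 'b set topology) homeomorphic_space
     product_topology (\<lambda>_::'b. discrete_topology (UNIV :: bool set)) UNIV"
    (is "_ homeomorphic_space ?P")
proof -
  have "continuous_map cantor_cube ?P (id \<circ> (\<lambda>S x. x \<in> S))"
    unfolding cantor_cube_def by (intro continuous_map_pullback) simp
  moreover have "continuous_map ?P cantor_cube Collect"
    unfolding cantor_cube_def by (rule continuous_map_pullback') (simp_all add: o_def)
  ultimately have "homeomorphic_maps cantor_cube ?P (\<lambda>S x. x \<in> S) Collect"
    by (simp add: homeomorphic_maps_def)
  then show ?thesis
    by (rule homeomorphic_maps_imp_homeomorphic_space)
qed

lemma compact_space_cantor_cube: "compact_space cantor_cube"
  using homeomorphic_compact_space[OF cantor_cube_homeomorphic]
  by (simp add: compact_space_product_topology compact_space_discrete_topology)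

lemma Hausdorff_space_cantor_cube: "Hausdorff_space cantor_cube"
  using homeomorphic_Hausdorff_space[OF cantor_cube_homeomorphic]
  by (simp add: Hausdorff_space_product_topology)

lemma completely_regular_space_cantor_cube: "completely_regular_space cantor_cube"
  using homeomorphic_completely_regular_space[OF cantor_cube_homeomorphic]
  by (simp add: completely_regular_space_product_topology completely_regular_space_discrete_topology)

lemma closedin_cantor_cube_Pow: "closedin cantor_cube (Pow C)"
proof -
  have "openin cantor_cube (- Pow C)"
    unfolding openin_cantor_cube
  proof
    fix S assume "S \<in> - Pow C"
    then obtain x where "x \<in> S" "x \<notin> C"
      by blast
    then show "\<exists>F. finite F \<and> (\<forall>S'. S' \<inter> F = S \<inter> F \<longrightarrow> S' \<in> - Pow C)"
      by (intro exI[of _ "{x}"]) auto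
  qed
  then show ?thesis
    by (simp add: closedin_def Compl_eq_Diff_UNIV)
qed

section \<open>The space\<close>

text \<open>
  The bound \<open>|UNIV|\<close> on the size of the second coordinate lies strictly below the cardinal of the full
  power set. If \<open>UNIV\<close> is infinite, unions of \<open>|UNIV|\<close> many sets respect it, which gives room for both
  compactness and neighbourhoods of all spikes at once.
\<close>

definition base :: "('b set \<times> 'b set set) set" where
  "base = {(S, B). |B| \<le>o |UNIV :: 'b set|}"

definition spike :: "'b \<Rightarrow> 'b set \<times> 'b set set" where
  "spike t = ({t}, UNIV)"

definition spiked_space :: "('b set \<times> 'b set set) topology" where
  "spiked_space = subtopology (prod_topology cantor_cube cantor_cube) (base \<union> range spike)"

lemma topspace_spiked_space: "topspace spiked_space = base \<union> range spike"
  by (simp add: spiked_space_def)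

lemma Tychonoff_spiked_space: "Tychonoff_space spiked_space"
  unfolding Tychonoff_space_def spiked_space_def
  by (simp add: completely_regular_space_subtopology Hausdorff_space_subtopology
      completely_regular_space_prod_topology Hausdorff_space_prod_topology
      completely_regular_space_cantor_cube Hausdorff_space_cantor_cube)

lemma UNIV_not_in_base: "(S, UNIV) \<notin> (base :: ('b set \<times> 'b set set) set)"
proof -
  have "|UNIV :: 'b set| <o |UNIV :: 'b set set|"
    using card_of_Pow[of "UNIV :: 'b set"] by simp
  then show ?thesis
    using not_ordLess_ordLeq by (auto simp: base_def)
qed

lemma openin_spiked_space_cylinder:
  assumes "openin cantor_cube V"
  shows "openin spiked_space ((V \<times> UNIV) \<inter> (base \<union> range spike))"
  unfolding spiked_space_def openin_subtopology
  using assms by (metis openin_prod_Times_iff openin_topspace topspace_cantor_cube)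

lemma openin_spiked_space_nbhd:
  assumes "openin spiked_space U" "(S, B) \<in> U"
  shows "\<exists>F G. finite F \<and> finite G \<and>
    (\<forall>S' B'. (S', B') \<in> base \<union> range spike \<longrightarrow> S' \<inter> F = S \<inter> F \<longrightarrow> B' \<inter> G = B \<inter> G \<longrightarrow> (S', B') \<in> U)"
proof -
  obtain T where T: "openin (prod_topology cantor_cube cantor_cube) T"
    "U = T \<inter> (base \<union> range spike)"
    using assms(1) by (auto simp: spiked_space_def openin_subtopology)
  have "(S, B) \<in> T"
    using assms(2) T(2) by simp
  with T(1) obtain V V' where V: "openin cantor_cube V" "openin cantor_cube V'" "S \<in> V" "B \<in> V'"
    "V \<times> V' \<subseteq> T"
    unfolding openin_prod_topology_alt by meson
  obtain F where F: "finite F" "\<And>S'. S' \<inter> F = S \<inter> F \<Longrightarrow> S' \<in> V"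
    using V(1,3) unfolding openin_cantor_cube by metis
  obtain G where G: "finite G" "\<And>B'. B' \<inter> G = B \<inter> G \<Longrightarrow> B' \<in> V'"
    using V(2,4) unfolding openin_cantor_cube by metis
  have "(S', B') \<in> U" if "(S', B') \<in> base \<union> range spike" "S' \<inter> F = S \<inter> F" "B' \<inter> G = B \<inter> G"
    for S' B'
  proof -
    have "(S', B') \<in> V \<times> V'"
      using F(2) G(2) that(2,3) by simp
    then show ?thesis
      using V(5) T(2) that(1) by auto
  qed
  then show ?thesis
    using F(1) G(1) by (intro exI[of _ F] exI[of _ G]) simp
qed

lemma closed_discrete_spikes: "closed_discrete spiked_space (range spike)"
proof -
  have "closedin cantor_cube {UNIV}"
    by (simp add: Hausdorff_imp_t1_space Hausdorff_space_cantor_cube closedin_t1_singleton)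
  then have "closedin (prod_topology cantor_cube cantor_cube) (UNIV \<times> {UNIV})"
    by (metis closedin_prod_Times_iff closedin_topspace topspace_cantor_cube)
  moreover have "range spike = (UNIV \<times> {UNIV}) \<inter> (base \<union> range spike)"
    using UNIV_not_in_base by (auto simp: spike_def)
  ultimately have "closedin spiked_space (range spike)"
    unfolding spiked_space_def closedin_subtopology by blast
  moreover have "subtopology spiked_space (range spike) = discrete_topology (range spike)"
  proof -
    have "openin (subtopology spiked_space (range spike)) {spike t}" for t
    proof -
      have "openin cantor_cube {S. t \<in> S}"
        unfolding openin_cantor_cube by (auto intro!: exI[of _ "{t}"])
      from openin_spiked_space_cylinder[OF this]
      have "openin (subtopology spiked_space (range spike))
        (({S. t \<in> S} \<times> UNIV) \<inter> (base \<union> range spike) \<inter> range spike)"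
        by (rule openin_subtopology_Int)
      moreover have "({S. t \<in> S} \<times> UNIV) \<inter> (base \<union> range spike) \<inter> range spike = {spike t}"
        by (auto simp: spike_def)
      ultimately show ?thesis
        by simp
    qed
    then show ?thesis
      by (intro sym[OF discrete_topology_unique[THEN iffD2]])
        (auto simp: topspace_spiked_space)
  qed
  ultimately show ?thesis
    by (simp add: closed_discrete_def)
qed

lemma card_le_extent_spiked_space:
  "|UNIV :: 'b set| \<le>o extent (spiked_space :: ('b set \<times> 'b set set) topology)"
proof -
  have "|UNIV :: 'b set| \<le>o |range (spike :: 'b \<Rightarrow> _)|"
    by (rule card_of_ordLeqI[of spike]) (auto intro!: injI simp: spike_def)
  also have "|range (spike :: 'b \<Rightarrow> _)| \<le>o extent (spiked_space :: ('b set \<times> 'b set set) topology)"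
    using extent_bound_extent closed_discrete_spikes unfolding extent_bound_def by blast
  finally show ?thesis .
qed

section \<open>The weak extent of the space\<close>

text \<open>
  If \<open>D\<close> is the union of the second coordinates, then \<open>Pow D\<close> is closed in the cube and consists of
  sets of admissible size, so \<open>UNIV \<times> Pow D\<close> is a compact set inside the base.
\<close>

lemma countable_subset_of_base_compact:
  assumes inf: "infinite (UNIV :: 'b set)"
    and C: "countable C" "C \<subseteq> (base :: ('b set \<times> 'b set set) set)"
  shows "\<exists>K. compactin spiked_space K \<and> C \<subseteq> K \<and> K \<subseteq> base"
proof -
  define D where "D = (\<Union>p\<in>C. snd p)"
  have "|C| \<le>o natLeq"
    using C(1) by (simp add: countable_card_le_natLeq)
  also have "natLeq \<le>o |UNIV :: 'b set|"
    using inf infinite_iff_natLeq_ordLeq by blast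
  finally have "|C| \<le>o |UNIV :: 'b set|" .
  then have D: "|D| \<le>o |UNIV :: 'b set|"
    unfolding D_def using inf C(2) by (intro card_of_UNION_ordLeq_infinite) (auto simp: base_def)
  have "UNIV \<times> Pow D \<subseteq> (base :: ('b set \<times> 'b set set) set)"
    using D by (auto simp: base_def intro: ordLeq_transitive[OF card_of_mono1])
  moreover have "compactin (prod_topology cantor_cube cantor_cube) (UNIV \<times> Pow D)"
  proof (rule closedin_compact_space)
    show "compact_space (prod_topology cantor_cube cantor_cube)"
      by (simp add: compact_space_prod_topology compact_space_cantor_cube)
    show "closedin (prod_topology cantor_cube cantor_cube) (UNIV \<times> Pow D)"
      by (metis closedin_prod_Times_iff closedin_topspace topspace_cantor_cube
          closedin_cantor_cube_Pow)
  qed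
  moreover have "C \<subseteq> UNIV \<times> Pow D"
    by (force simp: D_def)
  ultimately show ?thesis
    unfolding spiked_space_def compactin_subtopology by blast
qed

text \<open>
  One second coordinate, the union \<open>H\<close>, serves the neighbourhoods of all spikes simultaneously. In
  the first coordinate a single set cannot do so, since the neighbourhood of \<open>spike t\<close> may exclude
  finitely many elements other than \<open>t\<close>; a colour class contains none of these.
\<close>

lemma countable_star_covers_spikes:
  assumes inf: "infinite (UNIV :: 'b set)"
    and cover: "open_cover (spiked_space :: ('b set \<times> 'b set set) topology) \<U>"
  shows "\<exists>A. A \<subseteq> base \<and> countable A \<and> range spike \<subseteq> Star A \<U>"
proof -
  have "\<exists>U F G. U \<in> \<U> \<and> spike t \<in> U \<and> finite F \<and> finite G \<and>
     (\<forall>S B. (S, B) \<in> base \<longrightarrow> S \<inter> F = {t} \<inter> F \<longrightarrow> G \<subseteq> B \<longrightarrow> (S, B) \<in> U)" for t :: 'b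
  proof -
    obtain U where U: "U \<in> \<U>" "spike t \<in> U"
      using cover unfolding open_cover_def topspace_spiked_space by blast
    moreover have "openin spiked_space U"
      using cover U by (simp add: open_cover_def)
    ultimately obtain F G where FG: "finite F" "finite G"
      and nbhd: "\<forall>S B. (S, B) \<in> base \<union> range spike \<longrightarrow> S \<inter> F = {t} \<inter> F \<longrightarrow> B \<inter> G = UNIV \<inter> G \<longrightarrow> (S, B) \<in> U"
      using openin_spiked_space_nbhd[of U "{t}" UNIV] unfolding spike_def by blast
    have "(S, B) \<in> U" if "(S, B) \<in> base" "S \<inter> F = {t} \<inter> F" "G \<subseteq> B" for S B
    proof -
      have "B \<inter> G = UNIV \<inter> G" and "(S, B) \<in> base \<union> range spike"
        using that by auto
      then show ?thesis
        using nbhd that(2) by blast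
    qed
    then show ?thesis
      using U FG by blast
  qed
  then obtain U F G where U: "\<And>t. U t \<in> \<U>" "\<And>t. spike t \<in> U t"
    and fin: "\<And>t. finite (F t)" "\<And>t. finite (G t)"
    and nbhd: "\<And>t S B. (S, B) \<in> base \<Longrightarrow> S \<inter> F t = {t} \<inter> F t \<Longrightarrow> G t \<subseteq> B \<Longrightarrow> (S, B) \<in> U t"
    by metis
  obtain c :: "'b \<Rightarrow> nat" where c: "\<And>t s. s \<in> F t \<Longrightarrow> s \<noteq> t \<Longrightarrow> c s \<noteq> c t"
    using finite_outdegree_countable_colouring[of F] fin(1) by metis
  define H where "H = (\<Union>t. G t)"
  have "|G t| \<le>o |UNIV :: 'b set|" for t
  proof -
    have "|G t| \<le>o natLeq"
      using fin(2) by (simp add: countable_finite flip: countable_card_le_natLeq)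
    also have "natLeq \<le>o |UNIV :: 'b set|"
      using inf infinite_iff_natLeq_ordLeq by blast
    finally show ?thesis .
  qed
  then have "|H| \<le>o |UNIV :: 'b set|"
    unfolding H_def using inf by (intro card_of_UNION_ordLeq_infinite) (simp_all add: card_of_refl ordIso_imp_ordLeq)
  then have in_base: "(S, H) \<in> base" for S :: "'b set"
    by (simp add: base_def)
  \<comment> \<open>One point for each colour, with that colour class as first coordinate.\<close>
  define A where "A = range (\<lambda>n. ({s. c s = n}, H))"
  have "spike t \<in> Star A \<U>" for t
  proof -
    have "({s. c s = c t}, H) \<in> U t"
    proof (rule nbhd)
      show "{s. c s = c t} \<inter> F t = {t} \<inter> F t"
        using c by auto
      show "G t \<subseteq> H"
        by (auto simp: H_def)
    qed (rule in_base)
    then have "U t \<inter> A \<noteq> {}"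
      by (auto simp: A_def)
    then show ?thesis
      using U by (auto simp: Star_def)
  qed
  then show ?thesis
    using in_base by (intro exI[of _ A]) (auto simp: A_def)
qed

lemma weak_extent_spiked_space_le:
  assumes inf: "infinite (UNIV :: 'b set)"
  shows "weak_extent (spiked_space :: ('b set \<times> 'b set set) topology) \<le>o natLeq"
proof (rule weak_extent_le[OF natLeq_Card_order], unfold weak_extent_bound_def, intro allI impI)
  fix \<U> :: "('b set \<times> 'b set set) set set"
  assume cover: "open_cover spiked_space \<U>"
  have "\<exists>A\<subseteq>base. finite A \<and> base \<subseteq> Star A \<U>"
  proof (rule finite_star_covers)
    show "openin spiked_space U" if "U \<in> \<U>" for U
      using cover that by (simp add: open_cover_def)
    show "base \<subseteq> \<Union>\<U>"
      using cover by (auto simp: open_cover_def topspace_spiked_space)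
  qed (rule countable_subset_of_base_compact[OF inf])
  then obtain A where A: "A \<subseteq> base" "finite A" "base \<subseteq> Star A \<U>"
    by blast
  obtain A' where A': "A' \<subseteq> base" "countable A'" "range spike \<subseteq> Star A' \<U>"
    using countable_star_covers_spikes[OF inf cover] by blast
  have "Star (A \<union> A') \<U> \<subseteq> topspace spiked_space"
    using cover by (auto simp: open_cover_def Star_def)
  moreover have "Star A \<U> \<union> Star A' \<U> \<subseteq> Star (A \<union> A') \<U>"
    by (auto simp: Star_def)
  ultimately have "Star (A \<union> A') \<U> = topspace spiked_space"
    using A(3) A'(3) by (auto simp: topspace_spiked_space)
  moreover have "|A \<union> A'| \<le>o natLeq"
    using A(2) A'(2) by (simp add: countable_card_le_natLeq[symmetric] countable_finite)
  ultimately show "\<exists>A. A \<subseteq> topspace spiked_space \<and> |A| \<le>o natLeq \<and> Star A \<U> = topspace spiked_space"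
    using A(1) A'(1) by (intro exI[of _ "A \<union> A'"]) (auto simp: topspace_spiked_space)
qed

text \<open>
  Choose distinct elements \<open>i 0, i 1, \<dots>\<close>. The sets \<open>S\<close> whose least element among them is \<open>i n\<close> form
  an open set \<open>V n\<close> of the cube that contains \<open>{i n}\<close>, and these open sets are disjoint. Cover the
  spikes over the \<open>i n\<close> by the cylinders over the \<open>V n\<close>, and the remaining points by the complement
  of these spikes. The spike over \<open>i n\<close> is then in one member of the cover only, so a set whose star
  is the whole space meets each of infinitely many disjoint cylinders.
\<close>

lemma spiked_space_no_finite_star:
  assumes inf: "infinite (UNIV :: 'b set)"
  shows "\<exists>\<U>. open_cover (spiked_space :: ('b set \<times> 'b set set) topology) \<U> \<and>
    (\<forall>A. finite A \<longrightarrow> Star A \<U> \<noteq> topspace spiked_space)"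
proof -
  obtain i :: "nat \<Rightarrow> 'b" where i: "inj i"
    using inf infinite_countable_subset by blast
  define V where "V n = {S. i n \<in> S \<and> (\<forall>m<n. i m \<notin> S)}" for n
  have V_open: "openin cantor_cube (V n)" for n
    unfolding openin_cantor_cube
  proof
    fix S assume S: "S \<in> V n"
    have "S' \<in> V n" if S': "S' \<inter> i ` {..n} = S \<inter> i ` {..n}" for S'
    proof -
      have "i m \<in> S' \<longleftrightarrow> i m \<in> S" if "m \<le> n" for m
        using S' that by blast
      then show ?thesis
        using S by (simp add: V_def)
    qed
    then show "\<exists>F. finite F \<and> (\<forall>S'. S' \<inter> F = S \<inter> F \<longrightarrow> S' \<in> V n)"
      by (intro exI[of _ "i ` {..n}"]) auto
  qed
  have V_disj: "m = n" if "S \<in> V m" "S \<in> V n" for m n S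
    using that by (auto simp: V_def intro: linorder_cases[of m n])
  define U where "U n = (V n \<times> UNIV) \<inter> (base \<union> range spike)" for n
  have U_disj: "m = n" if "p \<in> U m" "p \<in> U n" for m n p
    using that V_disj by (auto simp: U_def)
  have spike_U: "spike (i n) \<in> U n" for n
    using i by (auto simp: U_def V_def spike_def inj_eq)
  define Z where "Z = range (spike \<circ> i)"
  define \<U> where "\<U> = insert (topspace spiked_space - Z) (range U)"
  have spikes: "closedin spiked_space (range (spike :: 'b \<Rightarrow> _))"
    "subtopology spiked_space (range (spike :: 'b \<Rightarrow> _)) = discrete_topology (range spike)"
    using closed_discrete_spikes[where 'a = 'b] by (simp_all add: closed_discrete_def)
  have "closedin spiked_space Z"
  proof (rule closedin_trans_full)
    \<comment> \<open>Every subset of a closed discrete set is closed.\<close>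
    show "closedin (subtopology spiked_space (range (spike :: 'b \<Rightarrow> _))) Z"
      unfolding spikes(2) by (auto simp: Z_def)
  qed (rule spikes(1))
  then have "\<forall>W\<in>\<U>. openin spiked_space W"
    using V_open openin_spiked_space_cylinder by (auto simp: \<U>_def U_def)
  moreover have "Z \<subseteq> \<Union>\<U>"
    using spike_U by (auto simp: Z_def \<U>_def)
  ultimately have "open_cover spiked_space \<U>"
    unfolding open_cover_def using openin_subset by (fastforce simp: \<U>_def)
  moreover have "Star A \<U> \<noteq> topspace spiked_space" if A: "finite A" for A
  proof
    assume star: "Star A \<U> = topspace spiked_space"
    have "\<exists>a\<in>A. a \<in> U n" for n
    proof -
      have "spike (i n) \<in> Star A \<U>"
        by (simp add: star topspace_spiked_space)
      then obtain W where W: "W \<in> \<U>" "spike (i n) \<in> W" "W \<inter> A \<noteq> {}"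
        by (auto simp: Star_def)
      have "W \<noteq> topspace spiked_space - Z"
        using W(2) by (auto simp: Z_def)
      then obtain m where "W = U m"
        using W(1) by (auto simp: \<U>_def)
      then show ?thesis
        using W U_disj[OF _ spike_U] by blast
    qed
    then obtain a where a: "\<And>n. a n \<in> A" "\<And>n. a n \<in> U n"
      by metis
    have "inj a"
      using a(2) U_disj by (metis injI)
    then have "infinite (range a)"
      by (rule range_inj_infinite)
    then show False
      using A a(1) by (meson finite_subset image_subsetI)
  qed
  ultimately show ?thesis
    by blast
qed

lemma natLeq_le_weak_extent_spiked_space:
  assumes inf: "infinite (UNIV :: 'b set)"
  shows "natLeq \<le>o weak_extent (spiked_space :: ('b set \<times> 'b set set) topology)"
proof (rule ccontr)
  let ?X = "spiked_space :: ('b set \<times> 'b set set) topology"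
  assume "\<not> natLeq \<le>o weak_extent ?X"
  then have less: "weak_extent ?X <o natLeq"
    using Card_order_weak_extent[of ?X] natLeq_Well_order not_ordLeq_iff_ordLess
    by (metis card_order_on_well_order_on)
  obtain \<U> where \<U>: "open_cover ?X \<U>" "\<And>A. finite A \<Longrightarrow> Star A \<U> \<noteq> topspace ?X"
    using spiked_space_no_finite_star[OF inf] by blast
  obtain A where A: "|A| \<le>o weak_extent ?X" "Star A \<U> = topspace ?X"
    using weak_extent_bound_weak_extent[of ?X] \<U>(1) unfolding weak_extent_bound_def by blast
  have "finite A"
    using ordLeq_ordLess_trans[OF A(1) less] by (simp add: finite_iff_ordLess_natLeq)
  then show False
    using \<U>(2) A(2) by blast
qed

theorem theorem1:
  fixes \<tau> :: "'a rel"
  assumes "Card_order \<tau>"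
  shows "\<exists>X :: 'a point topology.
    Tychonoff_space X \<and> \<tau> \<le>o extent X \<and> weak_extent X =o natLeq"
proof (intro exI conjI)
  have inf: "infinite (UNIV :: ('a + nat) set)"
    by (simp add: finite_Plus_UNIV_iff)
  let ?X = "spiked_space :: 'a point topology"
  show "Tychonoff_space ?X"
    by (rule Tychonoff_spiked_space)
  have "\<tau> =o |Field \<tau>|"
    using assms card_of_Field_ordIso ordIso_symmetric by blast
  also have "|Field \<tau>| \<le>o |UNIV :: ('a + nat) set|"
    by (rule card_of_ordLeqI[of Inl]) auto
  also have "|UNIV :: ('a + nat) set| \<le>o extent ?X"
    by (rule card_le_extent_spiked_space)
  finally show "\<tau> \<le>o extent ?X" .
  show "weak_extent ?X =o natLeq"
    by (simp add: ordIso_iff_ordLeq weak_extent_spiked_space_le[OF inf]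
        natLeq_le_weak_extent_spiked_space[OF inf])
qed

end
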